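(* Let $\mu$ be the vector of market weights and $A\in CBV([0,T],\mathbb{R}^m)$. Let $G:\mathbb{R}^d\times\mathbb{R}^m\to[0,\infty)$ be regular for the pair $(\mu,A)$, and let $\varphi$ be the trading strategy additively generated by $G$, with value $V^\varphi$. Suppose that: (i) $V^\varphi(t)=G(\mu(t),A(t))+\Gamma^G(t)\ge0$ for all $t\in[0,T]$; (ii) there is a function $F$ of $(\mu(t),A(t))$ such that $G(\mu(t),A(t))\ge F(\mu(t),A(t))$ for all $t\in[0,T]$ and the mapping $t\mapsto F(\mu(t),A(t))$ is nondecreasing on $[0,T]$; (iii) there is a constant $\kappa$ with $\Gamma^G(t)\ge-\kappa$ for all $t\in[0,T]$. Suppose that for some real number $T_*\in(0,T]$ $$F(\mu(T_* ),A(T_* ))>G(\mu(0),A(0))+\kappa.$$ Then $\varphi$ is strong arbitrage relative to the market over every time horizon $[0,t]$ with $T_*\le t\le T$.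
   Context: Partitions: $T>0$ is fixed, and $(\mathbb{T}_n)_{n\in\mathbb{N}}$ is a fixed sequence of finite partitions of $[0,T]$ (containing $0$ and $T$) with $\mathbb{T}_1\subset\mathbb{T}_2\subset\cdots$ and mesh tending to $0$. $[t_j,t_{j+1}]\in\mathbb{T}_n$ means that $t_j<t_{j+1}$ are consecutive points of $\mathbb{T}_n$; in sums over $[t_j,t_{j+1}]\in\mathbb{T}_n$ with $t_j\le t$, $t_{j+1}$ is replaced by $t$ when $j$ is the largest index with $t_j\le t$. Market weights: $S_1,\dots,S_d:[0,T]\to[0,\infty)$ ($d\ge2$) are continuous with $S_i(0)>0$ and $S_1(t)+\dots+S_d(t)>0$ for all $t$; $\mu_i(t)=S_i(t)/(S_1(t)+\dots+S_d(t))$. It is assumed that $\mu$ has pathwise quadratic covariations along $(\mathbb{T}_n)$: for all $i,k$ and $t$ the limit $\langle\mu_i,\mu_k\rangle(t)=\lim_n\sum_{[t_j,t_{j+1}]\in\mathbb{T}_n,\,t_j\le t}(\mu_i(t_{j+1})-\mu_i(t_j))(\mu_k(t_{j+1})-\mu_k(t_j))$ exists and is real-valued and continuous in $t$. $CBV([0,T],\mathbb{R}^m)$: continuous $\mathbb{R}^m$-valued functions of bounded variation on $[0,T]$. $\mathbb{C}^{2,1}$: functions on $\mathbb{R}^{d+m}$ twice continuously differentiable in the first $d$ variables and once continuously differentiable in the last $m$ variables; $\partial_i$ denotes the derivative in the $i$-th of the first $d$ variables. Integral: $\int_0^t\sum_{i=1}^d\partial_iG(\mu(s),A(s))\,d\mu_i(s):=\lim_{n}\sum_{[t_j,t_{j+1}]\in\mathbb{T}_n,\,t_j\le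 t}\sum_{i=1}^d\partial_iG(\mu(t_j),A(t_j))(\mu_i(t_{j+1})-\mu_i(t_j))$ (the limit exists by the pathwise Itô formula). Regular function: $G\in\mathbb{C}^{2,1}$ is regular for $(\mu,A)$ if $\Gamma^G(t):=G(\mu(0),A(0))-G(\mu(t),A(t))+\int_0^t\sum_i\partial_iG(\mu(s),A(s))\,d\mu_i(s)$, $0\le t\le T$, has finite variation on compact intervals of $[0,T]$. Additive generation: put $\vartheta_i(t)=\partial_iG(\mu(t),A(t))$, $V^\vartheta(t)=\sum_i\vartheta_i(t)\mu_i(t)$, $Q^\vartheta(t)=V^\vartheta(t)-V^\vartheta(0)-\int_0^t\sum_i\vartheta_i(s)\,d\mu_i(s)$, and $C(0)=\sum_i\partial_iG(\mu(0),A(0))\mu_i(0)-G(\mu(0),A(0))$. The trading strategy additively generated by $G$ is $\varphi_i(t)=\vartheta_i(t)-Q^\vartheta(t)-C(0)$, $i=1,\dots,d$; its value is $V^\varphi(t)=\sum_i\varphi_i(t)\mu_i(t)$, and one has $V^\varphi(t)=G(\mu(t),A(t))+\Gamma^G(t)$. Strong relative arbitrage: a trading strategy $\varphi$ is strong arbitrage relative to the market over $[0,t]$, $t\in(0,T]$, if $V^\varphi(s)\ge0$ for all $s\in[0,t]$ and $V^\varphi(t)>V^\varphi(0)$. *)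

theory Defs
  imports "HOL-Analysis.Analysis"
begin

section \<open>Partitions and pathwise limits along them\<close>

definition consecutive :: "real set \<Rightarrow> (real \<times> real) set" where
  "consecutive P = {(s, u). s \<in> P \<and> u \<in> P \<and> s < u \<and> P \<inter> {s<..<u} = {}}"

definition mesh :: "real set \<Rightarrow> real" where
  "mesh P = Max ((\<lambda>(s, u). u - s) ` consecutive P)"

definition partition_sequence :: "real \<Rightarrow> (nat \<Rightarrow> real set) \<Rightarrow> bool" where
  "partition_sequence T \<T> \<longleftrightarrow>
     (\<forall>n. finite (\<T> n) \<and> \<T> n \<subseteq> {0..T} \<and> 0 \<in> \<T> n \<and> T \<in> \<T> n) \<and>
     incseq \<T> \<and> (\<lambda>n. mesh (\<T> n)) \<longlonglongrightarrow> 0"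

text \<open>Sum over the steps of \<open>P\<close> that start no later than \<open>t\<close>.  The end point \<open>u\<close> of a step
  exceeds \<open>t\<close> only in the step starting at the largest point \<open>\<le> t\<close>; there, \<open>min u t\<close> replaces
  it by \<open>t\<close>.\<close>

definition partition_sum :: "real set \<Rightarrow> real \<Rightarrow> (real \<Rightarrow> real \<Rightarrow> real) \<Rightarrow> real" where
  "partition_sum P t f = (\<Sum>(s, u) \<in> {(s, u) \<in> consecutive P. s \<le> t}. f s (min u t))"

definition qcov_sum ::
  "(nat \<Rightarrow> real set) \<Rightarrow> (real \<Rightarrow> real ^ 'd) \<Rightarrow> 'd \<Rightarrow> 'd \<Rightarrow> real \<Rightarrow> nat \<Rightarrow> real" where
  "qcov_sum \<T> \<mu> i k t n =
     partition_sum (\<T> n) t (\<lambda>s u. (\<mu> u $ i - \<mu> s $ i) * (\<mu> u $ k - \<mu> s $ k))"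

definition qcov ::
  "(nat \<Rightarrow> real set) \<Rightarrow> (real \<Rightarrow> real ^ 'd) \<Rightarrow> 'd \<Rightarrow> 'd \<Rightarrow> real \<Rightarrow> real" where
  "qcov \<T> \<mu> i k t = lim (qcov_sum \<T> \<mu> i k t)"

definition has_quadratic_covariations ::
  "real \<Rightarrow> (nat \<Rightarrow> real set) \<Rightarrow> (real \<Rightarrow> real ^ 'd) \<Rightarrow> bool" where
  "has_quadratic_covariations T \<T> \<mu> \<longleftrightarrow>
     (\<forall>i k. (\<forall>t\<in>{0..T}. convergent (qcov_sum \<T> \<mu> i k t)) \<and>
            continuous_on {0..T} (qcov \<T> \<mu> i k))"

text \<open>For \<open>\<theta> = \<nabla>G(\<mu>, A)\<close> with \<open>G\<close> of class \<open>C21\<close> and \<open>A\<close> continuous of bounded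
  variation, the limit exists by the pathwise Ito formula.\<close>

definition pathwise_integral ::
  "(nat \<Rightarrow> real set) \<Rightarrow> (real \<Rightarrow> real ^ 'd) \<Rightarrow> (real \<Rightarrow> real ^ 'd) \<Rightarrow> real \<Rightarrow> real" where
  "pathwise_integral \<T> \<theta> \<mu> t =
     lim (\<lambda>n. partition_sum (\<T> n) t (\<lambda>s u. \<Sum>i\<in>UNIV. \<theta> s $ i * (\<mu> u $ i - \<mu> s $ i)))"


section \<open>Function classes\<close>

definition bounded_variation_on ::
  "real \<Rightarrow> real \<Rightarrow> (real \<Rightarrow> 'b::real_normed_vector) \<Rightarrow> bool" where
  "bounded_variation_on a b f \<longleftrightarrow>
     (\<exists>B. \<forall>P. finite P \<and> P \<subseteq> {a..b} \<longrightarrow> (\<Sum>(s, u)\<in>consecutive P. norm (f u - f s)) \<le> B)"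

definition CBV :: "real \<Rightarrow> (real \<Rightarrow> real ^ 'm) set" where
  "CBV T = {A. continuous_on {0..T} A \<and> bounded_variation_on 0 T A}"

definition dir_deriv :: "'b::real_normed_vector \<Rightarrow> ('b \<Rightarrow> real) \<Rightarrow> 'b \<Rightarrow> real" where
  "dir_deriv v f p = deriv (\<lambda>h. f (p + h *\<^sub>R v)) 0"

definition has_cont_dir_deriv :: "'b::real_normed_vector \<Rightarrow> ('b \<Rightarrow> real) \<Rightarrow> bool" where
  "has_cont_dir_deriv v f \<longleftrightarrow>
     (\<forall>p. (\<lambda>h. f (p + h *\<^sub>R v)) field_differentiable at 0) \<and> continuous_on UNIV (dir_deriv v f)"

text \<open>Along \<open>unit1 i\<close> and \<open>unit2 k\<close>, \<open>dir_deriv\<close> is the partial derivative in the \<open>i\<close>-th of the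
  first \<open>d\<close> and the \<open>k\<close>-th of the last \<open>m\<close> variables.  All derivatives in \<open>C21\<close> are jointly
  continuous in the \<open>d + m\<close> variables.\<close>

definition unit1 :: "'d::finite \<Rightarrow> (real ^ 'd) \<times> (real ^ 'm)" where
  "unit1 i = (axis i 1, 0)"

definition unit2 :: "'m::finite \<Rightarrow> (real ^ 'd) \<times> (real ^ 'm)" where
  "unit2 k = (0, axis k 1)"

definition C21 :: "((real ^ 'd) \<times> (real ^ 'm) \<Rightarrow> real) set" where
  "C21 = {G. (\<forall>i. has_cont_dir_deriv (unit1 i) G) \<and>
             (\<forall>i j. has_cont_dir_deriv (unit1 j) (dir_deriv (unit1 i) G)) \<and>
             (\<forall>k. has_cont_dir_deriv (unit2 k) G)}"


section \<open>Market weights and additively generated strategies\<close>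

definition market_weights :: "('d::finite \<Rightarrow> real \<Rightarrow> real) \<Rightarrow> real \<Rightarrow> real ^ 'd" where
  "market_weights S t = (\<chi> i. S i t / (\<Sum>k\<in>UNIV. S k t))"

definition grad_process ::
  "((real ^ 'd) \<times> (real ^ 'm) \<Rightarrow> real) \<Rightarrow> (real \<Rightarrow> real ^ 'd) \<Rightarrow> (real \<Rightarrow> real ^ 'm) \<Rightarrow>
     real \<Rightarrow> real ^ 'd" where
  "grad_process G \<mu> A t = (\<chi> i. dir_deriv (unit1 i) G (\<mu> t, A t))"

definition Gamma_process ::
  "(nat \<Rightarrow> real set) \<Rightarrow> ((real ^ 'd) \<times> (real ^ 'm) \<Rightarrow> real) \<Rightarrow> (real \<Rightarrow> real ^ 'd) \<Rightarrow>
     (real \<Rightarrow> real ^ 'm) \<Rightarrow> real \<Rightarrow> real" where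
  "Gamma_process \<T> G \<mu> A t =
     G (\<mu> 0, A 0) - G (\<mu> t, A t) + pathwise_integral \<T> (grad_process G \<mu> A) \<mu> t"

definition regular ::
  "real \<Rightarrow> (nat \<Rightarrow> real set) \<Rightarrow> (real \<Rightarrow> real ^ 'd) \<Rightarrow> (real \<Rightarrow> real ^ 'm) \<Rightarrow>
     ((real ^ 'd) \<times> (real ^ 'm) \<Rightarrow> real) \<Rightarrow> bool" where
  "regular T \<T> \<mu> A G \<longleftrightarrow> G \<in> C21 \<and>
     (\<forall>a b. 0 \<le> a \<and> a \<le> b \<and> b \<le> T \<longrightarrow> bounded_variation_on a b (Gamma_process \<T> G \<mu> A))"

definition strategy_value :: "(real \<Rightarrow> real ^ 'd) \<Rightarrow> (real \<Rightarrow> real ^ 'd) \<Rightarrow> real \<Rightarrow> real" where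
  "strategy_value \<mu> \<phi> t = (\<Sum>i\<in>UNIV. \<phi> t $ i * \<mu> t $ i)"

text \<open>The process \<open>Q\<close>, which vanishes iff \<open>\<theta>\<close> is self-financing; subtracting it, and the constant
  \<open>C(0)\<close> below, from every component of \<open>\<theta>\<close> gives the additively generated strategy.\<close>

definition financing_defect ::
  "(nat \<Rightarrow> real set) \<Rightarrow> (real \<Rightarrow> real ^ 'd) \<Rightarrow> (real \<Rightarrow> real ^ 'd) \<Rightarrow> real \<Rightarrow> real" where
  "financing_defect \<T> \<mu> \<theta> t =
     strategy_value \<mu> \<theta> t - strategy_value \<mu> \<theta> 0 - pathwise_integral \<T> \<theta> \<mu> t"

definition initial_constant ::
  "((real ^ 'd) \<times> (real ^ 'm) \<Rightarrow> real) \<Rightarrow> (real \<Rightarrow> real ^ 'd) \<Rightarrow> (real \<Rightarrow> real ^ 'm) \<Rightarrow> real" where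
  "initial_constant G \<mu> A =
     (\<Sum>i\<in>UNIV. dir_deriv (unit1 i) G (\<mu> 0, A 0) * \<mu> 0 $ i) - G (\<mu> 0, A 0)"

definition additively_generated ::
  "(nat \<Rightarrow> real set) \<Rightarrow> (real \<Rightarrow> real ^ 'd) \<Rightarrow> (real \<Rightarrow> real ^ 'm) \<Rightarrow>
     ((real ^ 'd) \<times> (real ^ 'm) \<Rightarrow> real) \<Rightarrow> real \<Rightarrow> real ^ 'd" where
  "additively_generated \<T> \<mu> A G t =
     (\<chi> i. grad_process G \<mu> A t $ i - financing_defect \<T> \<mu> (grad_process G \<mu> A) t
           - initial_constant G \<mu> A)"

definition strong_relative_arbitrage ::
  "(real \<Rightarrow> real ^ 'd) \<Rightarrow> (real \<Rightarrow> real ^ 'd) \<Rightarrow> real \<Rightarrow> bool" where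
  "strong_relative_arbitrage \<mu> \<phi> t \<longleftrightarrow>
     (\<forall>s\<in>{0..t}. 0 \<le> strategy_value \<mu> \<phi> s) \<and> strategy_value \<mu> \<phi> 0 < strategy_value \<mu> \<phi> t"

end

theory Submission
  imports Defs
begin

text \<open>Since the market weights sum to one, subtracting \<open>Q + C(0)\<close> from every component of \<open>\<nabla>G\<close>
  lowers the value by exactly \<open>Q + C(0)\<close>, whence \<open>V = G + \<Gamma>\<close>, with \<open>\<Gamma>(0) = 0\<close>.  For \<open>t \<ge> T\<^sub>*\<close> this
  gives \<open>V(t) \<ge> F(T\<^sub>*) - \<kappa> > G(0) = V(0)\<close>.\<close>

lemma sum_market_weights:
  assumes "(\<Sum>i\<in>UNIV. S i t) \<noteq> 0"
  shows "(\<Sum>i\<in>UNIV. market_weights S t $ i) = 1"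
  using assms by (simp add: market_weights_def flip: sum_divide_distrib)

text \<open>The identity is algebraic: the integral enters \<open>financing_defect\<close> and
  \<open>Gamma_process\<close> as the same limit, so both sides reduce to
  \<open>G (\<mu> 0, A 0)\<close> plus that integral.\<close>

lemma strategy_value_additively_generated:
  assumes "(\<Sum>i\<in>UNIV. \<mu> t $ i) = 1"
  shows "strategy_value \<mu> (additively_generated \<T> \<mu> A G) t
    = G (\<mu> t, A t) + Gamma_process \<T> G \<mu> A t"
proof -
  let ?\<theta> = "grad_process G \<mu> A"
  let ?c = "financing_defect \<T> \<mu> ?\<theta> t + initial_constant G \<mu> A"
  have "strategy_value \<mu> (additively_generated \<T> \<mu> A G) t
      = strategy_value \<mu> ?\<theta> t - ?c * (\<Sum>i\<in>UNIV. \<mu> t $ i)"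
    by (simp add: strategy_value_def additively_generated_def sum_distrib_left
        sum_distrib_right algebra_simps sum.distrib sum_subtractf)
  \<comment> \<open>In \<open>?c\<close> the initial value of \<open>?\<theta>\<close> then cancels
    against the one subtracted in \<open>financing_defect\<close>.\<close>
  moreover have "initial_constant G \<mu> A = strategy_value \<mu> ?\<theta> 0 - G (\<mu> 0, A 0)"
    by (simp add: initial_constant_def strategy_value_def grad_process_def)
  ultimately show ?thesis
    using assms by (simp add: financing_defect_def Gamma_process_def)
qed

text \<open>Points of \<open>P\<close> are nonnegative, so a step starting no later than 0 starts at
  0, and \<open>min\<close> truncates its end to 0: it contributes \<open>f 0 0\<close>.\<close>

lemma partition_sum_0:
  assumes "P \<subseteq> {0..}" and "f 0 0 = 0"
  shows "partition_sum P 0 f = 0"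
  unfolding partition_sum_def
proof (rule sum.neutral, clarify)
  fix s u :: real
  assume "(s, u) \<in> consecutive P" and "s \<le> 0"
  then have "s = 0" and "0 < u"
    using assms(1) by (auto simp: consecutive_def)
  then show "f s (min u 0) = 0"
    using assms(2) by simp
qed

text \<open>At time 0 the increments of \<open>\<mu>\<close> vanish, so the integral is the limit of
  a constant zero sequence.\<close>

lemma Gamma_process_0:
  assumes "\<And>n. \<T> n \<subseteq> {0..}"
  shows "Gamma_process \<T> G \<mu> A 0 = 0"
  using assms by (simp add: Gamma_process_def pathwise_integral_def partition_sum_0)

theorem theorem4p5:
  fixes T Tstar \<kappa> :: real
    and \<T> :: "nat \<Rightarrow> real set"
    and S :: "'d::finite \<Rightarrow> real \<Rightarrow> real"
    and \<mu> :: "real \<Rightarrow> real ^ 'd"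
    and A :: "real \<Rightarrow> real ^ 'm::finite"
    and G F :: "(real ^ 'd) \<times> (real ^ 'm) \<Rightarrow> real"
    and \<phi> :: "real \<Rightarrow> real ^ 'd"
  defines "\<mu> \<equiv> market_weights S"
    and "\<phi> \<equiv> additively_generated \<T> \<mu> A G"
  assumes "0 < T"
    and "partition_sequence T \<T>"
    and "2 \<le> CARD('d)"
    and "\<And>i. continuous_on {0..T} (S i)"
    and "\<And>i t. t \<in> {0..T} \<Longrightarrow> 0 \<le> S i t"
    and "\<And>i. 0 < S i 0"
    and "\<And>t. t \<in> {0..T} \<Longrightarrow> 0 < (\<Sum>i\<in>UNIV. S i t)"
    and "has_quadratic_covariations T \<T> \<mu>"
    and "A \<in> CBV T"
    and "\<And>p. 0 \<le> G p"
    and "regular T \<T> \<mu> A G"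
    and "\<And>t. t \<in> {0..T} \<Longrightarrow> 0 \<le> G (\<mu> t, A t) + Gamma_process \<T> G \<mu> A t"
    and "\<And>t. t \<in> {0..T} \<Longrightarrow> F (\<mu> t, A t) \<le> G (\<mu> t, A t)"
    and "mono_on {0..T} (\<lambda>t. F (\<mu> t, A t))"
    and "\<And>t. t \<in> {0..T} \<Longrightarrow> - \<kappa> \<le> Gamma_process \<T> G \<mu> A t"
    and "Tstar \<in> {0<..T}"
    and "G (\<mu> 0, A 0) + \<kappa> < F (\<mu> Tstar, A Tstar)"
  shows "\<forall>t\<in>{Tstar..T}. strong_relative_arbitrage \<mu> \<phi> t"
proof (intro ballI)
  fix t assume t: "t \<in> {Tstar..T}"
  have V: "strategy_value \<mu> \<phi> s = G (\<mu> s, A s) + Gamma_process \<T> G \<mu> A s"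
    if "s \<in> {0..T}" for s
    \<comment> \<open>Positive total capitalization makes the weights sum to one.\<close>
    unfolding \<phi>_def \<mu>_def using assms(9)[OF that]
    by (intro strategy_value_additively_generated sum_market_weights) simp
  have "\<And>n. \<T> n \<subseteq> {0..}"
    using assms(4) by (fastforce simp: partition_sequence_def)
  then have V0: "strategy_value \<mu> \<phi> 0 = G (\<mu> 0, A 0)"
    using V[of 0] \<open>0 < T\<close> by (simp add: Gamma_process_0)
  have t': "t \<in> {0..T}" and Tstar: "Tstar \<in> {0..T}"
    using t assms(18) by auto
  have "strategy_value \<mu> \<phi> 0 < F (\<mu> Tstar, A Tstar) - \<kappa>"
    using assms(19) V0 by simp
  \<comment> \<open>Monotonicity of \<open>F\<close> along the path carries the strict gap at
    \<open>Tstar\<close> to every later horizon.\<close>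
  also have "\<dots> \<le> F (\<mu> t, A t) - \<kappa>"
    using mono_onD[OF assms(16) Tstar t'] t by simp
  \<comment> \<open>The two lower bounds, \<open>F\<close> for \<open>G\<close> and
    \<open>- \<kappa>\<close> for \<open>Gamma_process\<close>, add up by \<open>V\<close>.\<close>
  also have "\<dots> \<le> strategy_value \<mu> \<phi> t"
    using V[OF t'] assms(15)[OF t'] assms(17)[OF t'] by simp
  \<comment> \<open>Nonnegativity up to \<open>t\<close> is hypothesis (i) read through
    \<open>V\<close>.\<close>
  finally show "strong_relative_arbitrage \<mu> \<phi> t"
    using V assms(14) t' by (simp add: strong_relative_arbitrage_def)
qed

end
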